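(* Let $p\ge 1$, let $(\mathbb{X},d_{\mathbb{X}})$ be a totally bounded metric space ($\mathbb{X}$ being Polish), let $\pi$ be a prior (a probability measure on $\mathcal{P}(\mathbb{X})$), and let $\mathfrak{p}_0\in\mathcal{P}(\mathbb{X})$. Assume that there exists a distinguished version $\pi_n^{\ast}(\cdot|\cdot)$ of the posterior distribution satisfying, with some positive constant $L_n$, $$\mathcal{W}_p^{(\mathcal{P}(\mathcal{P}(\mathbb{X})))}\big(\pi_n^{\ast}(\cdot|x^{(n)});\pi_n^{\ast}(\cdot|y^{(n)})\big)\le L_n\,\mathcal{W}_p^{(\mathcal{P}(\mathbb{X}))}\big(\mathfrak{e}_n^{(x)};\mathfrak{e}_n^{(y)}\big)\qquad\text{for all }x^{(n)},y^{(n)}\in\mathbb{X}^n .$$ In this framework, for any infinitesimal sequence $(\delta_n)$ of positive numbers, consider the $p$-Wasserstein posterior contraction rate at $\mathfrak{p}_0$ given by $$\epsilon_n=\varepsilon_{n,p}(\mathbb{X},\mathfrak{p}_0)+2(2+L_n)\delta_n+\mathrm{diam}(\mathbb{X})\Big\{\tfrac12\big[M_n(N_{\delta_n},\delta_n)+V_n(N_{\delta_n},\delta_n)\big]\Big\}^{1/p}.\qquad(\ast)$$ Assume in addition that: i) $N_\delta(\mathbb{X},d_{\mathbb{X}})\sim(1/\delta)^d$ for some $d>0$, as $\delta\to0$; ii) $L_n\sim n^s$ for some $s\ge0$, as $n\to+\infty$; iii) for any $\delta>0$, there holds $M_n(N_\delta,\delta)+V_n(N_\delta,\delta)\le C(\pi)\,N_\delta\,n^{-\alpha}$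 for some positive constant $C(\pi)$ depending only on the prior $\pi$ and $\alpha>sd$. Then the $p$-Wasserstein posterior contraction rate $(\ast)$ has an upper bound whose asymptotic expansion, as $n\to+\infty$, is $$\varepsilon_{n,p}(\mathbb{X},\mathfrak{p}_0)+n^{-(\alpha-ds)/(d+p)}.$$
   Context: Convention. $a_n\sim b_n$ means that $a_n$ and $b_n$ are of the same asymptotic order (similarly for functions of $\delta\to0$). Setting. $\mathbb{X}$ carries its Borel $\sigma$-field. For a separable metric space $\mathbb{S}$, $\mathcal{P}(\mathbb{S})$ denotes the Borel probability measures on $\mathbb{S}$. $\mathcal{P}(\mathbb{X})$ carries the Borel $\sigma$-field of the weak topology. All random elements live on a probability space $(\Omega,\mathscr{F},\mathsf{P})$ with expectation $\mathsf{E}$. Let $\tilde{\mathfrak{p}}$ be a random probability measure on $\mathbb{X}$ with law $\pi$ (the prior) and, conditionally on $\tilde{\mathfrak{p}}$, let $X_1,X_2,\dots$ be i.i.d. with law $\tilde{\mathfrak{p}}$. Let $\mu_n$ be the law of $(X_1,\dots,X_n)$. A version of the posterior distribution is a probability kernel $\pi_n(\cdot|\cdot)$ from $\mathbb{X}^n$ to $\mathcal{P}(\mathbb{X})$ solving the disintegration $$\mathsf{P}[X_1\in A_1,\dots,X_n\in A_n,\tilde{\mathfrak{p}}\in B]=\int_{A_1\times\dots\times A_n}\pi_n(B|x^{(n)})\,\mu_n(dx^{(n)})$$ for all Borel $A_1,\dots,A_n\subseteq\mathbb{X}$ and $B\subseteq\mathcal{P}(\mathbb{X})$, where $x^{(n)}=(x_1,\dots,x_n)$.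 Data. $\xi_1,\xi_2,\dots$ are i.i.d. $\mathbb{X}$-valued random variables with law $\mathfrak{p}_0$. For a sequence $z=(z_i)$, $\mathfrak{e}_n^{(z)}:=\frac1n\sum_{i=1}^n\delta_{z_i}$. Wasserstein distances. For a separable metric space $(\mathbb{S},d_{\mathbb{S}})$, $\mathcal{W}_p^{(\mathcal{P}(\mathbb{S}))}(\gamma_1;\gamma_2):=\inf_{\eta}\big(\int_{\mathbb{S}^2}d_{\mathbb{S}}(x,y)^p\,\eta(dx\,dy)\big)^{1/p}$, the infimum being over probability measures $\eta$ on $\mathbb{S}^2$ with marginals $\gamma_1,\gamma_2$. $\mathcal{W}_p^{(\mathcal{P}(\mathcal{P}(\mathbb{X})))}$ is built on the base metric space $(\mathcal{P}(\mathbb{X}),\mathcal{W}_p^{(\mathcal{P}(\mathbb{X}))})$, where $\mathcal{W}_p^{(\mathcal{P}(\mathbb{X}))}$ is built on $(\mathbb{X},d_{\mathbb{X}})$. Posterior contraction rate. A sequence $(\epsilon_n)$ of positive numbers is a posterior contraction rate at $\mathfrak{p}_0$ with respect to $\mathcal{W}_p^{(\mathcal{P}(\mathbb{X}))}$ if $\pi_n^{\ast}(\{\mathfrak{p}:\mathcal{W}_p^{(\mathcal{P}(\mathbb{X}))}(\mathfrak{p};\mathfrak{p}_0)\ge K_n\epsilon_n\}|\xi_1,\dots,\xi_n)\to0$ in probability for every sequence of positive numbers $K_n\to+\infty$. It is called a $p$-Wasserstein posterior contraction rate when it is obtained as (an upper bound for) $\mathsf{E}[\mathcal{W}_p^{(\mathcal{P}(\mathcal{P}(\mathbb{X})))}(\pi_n^{\ast}(\cdot|\xi_1,\dots,\xi_n);\delta_{\mathfrak{p}_0})]$.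 Notation in the bound. $\varepsilon_{n,p}(\mathbb{X},\mathfrak{p}_0):=\mathsf{E}[\mathcal{W}_p^{(\mathcal{P}(\mathbb{X}))}(\mathfrak{e}_n^{(\xi)};\mathfrak{p}_0)]$ is the rate of convergence of the mean Glivenko-Cantelli theorem. $N_\delta=N_\delta(\mathbb{X},d_{\mathbb{X}})$ is the $\delta$-covering number of $(\mathbb{X},d_{\mathbb{X}})$. For $\delta>0$ and $N=N_\delta$, let $\{A_{j,\delta}\}_{j=1,\dots,N}$ be a fixed partition of $\mathbb{X}$ into Borel sets with $\mathrm{diam}(A_{j,\delta})\le2\delta$ and $\mu_1(\partial A_{j,\delta})=0$ for all $j$. Put $\phi_{j,n}^{(\xi)}:=\frac1n\sum_{i=1}^n\mathbf{1}\{\xi_i\in A_{j,\delta}\}$, let $\pi_{N,j}$ be the law on $[0,1]$ of $\tilde{\mathfrak{p}}(A_{j,\delta})$, and set $$m_{j,n}^{(\xi)}:=\frac{\int_0^1t^{1+n\phi_{j,n}^{(\xi)}}(1-t)^{n(1-\phi_{j,n}^{(\xi)})}\pi_{N,j}(dt)}{\int_0^1t^{n\phi_{j,n}^{(\xi)}}(1-t)^{n(1-\phi_{j,n}^{(\xi)})}\pi_{N,j}(dt)},\qquad v_{j,n}^{(\xi)}:=\frac{\int_0^1[t-m_{j,n}^{(\xi)}]^2t^{n\phi_{j,n}^{(\xi)}}(1-t)^{n(1-\phi_{j,n}^{(\xi)})}\pi_{N,j}(dt)}{\int_0^1t^{n\phi_{j,n}^{(\xi)}}(1-t)^{n(1-\phi_{j,n}^{(\xi)})}\pi_{N,j}(dt)},$$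 $$M_n(N,\delta):=\sum_{j=1}^N\mathsf{E}\big[|\phi_{j,n}^{(\xi)}-m_{j,n}^{(\xi)}|\big],\qquad V_n(N,\delta):=\sum_{j=1}^N\mathsf{E}\Big[\sqrt{v_{j,n}^{(\xi)}}\Big].$$ *)

theory Defs
  imports "HOL-Probability.Probability" "HOL-Library.Landau_Symbols"
begin

section \<open>Spaces of probability measures\<close>

definition prob_measures :: "'a::topological_space measure set" where
  "prob_measures = {\<mu>. prob_space \<mu> \<and> sets \<mu> = sets borel}"

text \<open>The coarsest topology making \<open>\<mu> \<mapsto> \<integral>f d\<mu>\<close> continuous for all bounded continuous \<open>f\<close>.
  Its carrier is \<^const>\<open>prob_measures\<close> (take \<open>U = UNIV\<close>), the set of all Borel probability measures.\<close>

definition weak_topology :: "'a::topological_space measure topology" where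
  "weak_topology = topology_generated_by
     {{\<mu> \<in> prob_measures. (\<integral>x. f x \<partial>\<mu>) \<in> U} | (f :: 'a \<Rightarrow> real) U.
        continuous_on UNIV f \<and> bounded (range f) \<and> open U}"

definition borel_P :: "'a::topological_space measure measure" where
  "borel_P = sigma prob_measures {U. openin weak_topology U}"

section \<open>Wasserstein distances\<close>

definition couplings :: "'s measure \<Rightarrow> 's measure \<Rightarrow> 's measure \<Rightarrow> ('s \<times> 's) measure set" where
  "couplings S \<gamma>\<^sub>1 \<gamma>\<^sub>2 =
     {\<eta> \<in> space (prob_algebra (S \<Otimes>\<^sub>M S)). distr \<eta> S fst = \<gamma>\<^sub>1 \<and> distr \<eta> S snd = \<gamma>\<^sub>2}"

definition ennreal_powr :: "ennreal \<Rightarrow> real \<Rightarrow> ennreal" where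
  "ennreal_powr x a = (if x = \<top> then \<top> else ennreal (enn2real x powr a))"

text \<open>\<open>S\<close> is the measurable space underlying the metric \<open>dS\<close>. The infimum is taken in
  \<open>[0, \<infinity>]\<close>, so that couplings of infinite cost are harmless; the final
  \<^const>\<open>enn2real\<close> loses nothing when \<open>dS\<close> is bounded, which is the case in all uses below.\<close>

definition wasserstein ::
    "'s measure \<Rightarrow> ('s \<Rightarrow> 's \<Rightarrow> real) \<Rightarrow> real \<Rightarrow> 's measure \<Rightarrow> 's measure \<Rightarrow> real" where
  "wasserstein S dS p \<gamma>\<^sub>1 \<gamma>\<^sub>2 = enn2real
     (INF \<eta> \<in> couplings S \<gamma>\<^sub>1 \<gamma>\<^sub>2. ennreal_powr (\<integral>\<^sup>+z. ennreal (dS (fst z) (snd z) powr p) \<partial>\<eta>) (1 / p))"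

definition W_P :: "real \<Rightarrow> 'a::metric_space measure \<Rightarrow> 'a measure \<Rightarrow> real" where
  "W_P p = wasserstein borel dist p"

text \<open>The Borel \<open>\<sigma>\<close>-field of the metric \<^term>\<open>W_P p\<close> is that of the weak topology when \<open>dist\<close> is
  bounded and separable, hence the use of \<^const>\<open>borel_P\<close>.\<close>

definition W_PP :: "real \<Rightarrow> 'a::metric_space measure measure \<Rightarrow> 'a measure measure \<Rightarrow> real" where
  "W_PP p = wasserstein borel_P (W_P p) p"

section \<open>Bayesian model\<close>

text \<open>Samples \<open>(x\<^sub>1, \<dots>, x\<^sub>n)\<close> are functions on the index set \<open>{..<n}\<close>; sequences start at index 0.\<close>

definition sample_space :: "nat \<Rightarrow> (nat \<Rightarrow> 'a::topological_space) measure" where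
  "sample_space n = (\<Pi>\<^sub>M i\<in>{..<n}. borel)"

definition sample :: "(nat \<Rightarrow> 'w \<Rightarrow> 'a) \<Rightarrow> nat \<Rightarrow> 'w \<Rightarrow> nat \<Rightarrow> 'a" where
  "sample X n \<omega> = (\<lambda>i\<in>{..<n}. X i \<omega>)"

definition empirical :: "nat \<Rightarrow> (nat \<Rightarrow> 'a::topological_space) \<Rightarrow> 'a measure" where
  "empirical n z = measure_of UNIV (sets borel) (\<lambda>A. ennreal (1 / real n) * (\<Sum>i<n. indicator A (z i)))"

definition cond_iid ::
    "'w measure \<Rightarrow> ('w \<Rightarrow> 'a::topological_space measure) \<Rightarrow> (nat \<Rightarrow> 'w \<Rightarrow> 'a) \<Rightarrow> bool" where
  "cond_iid M P X \<longleftrightarrow>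
     (\<forall>i. X i \<in> M \<rightarrow>\<^sub>M borel) \<and>
     (\<forall>n A. (\<forall>i<n. A i \<in> sets borel) \<longrightarrow>
        (AE \<omega> in M. real_cond_exp M (vimage_algebra (space M) P borel_P)
             (indicator {\<omega>\<in>space M. \<forall>i<n. X i \<omega> \<in> A i}) \<omega> = (\<Prod>i<n. measure (P \<omega>) (A i))))"

definition posterior_version ::
    "'w measure \<Rightarrow> ('w \<Rightarrow> 'a::topological_space measure) \<Rightarrow> (nat \<Rightarrow> 'w \<Rightarrow> 'a) \<Rightarrow> nat \<Rightarrow>
     ((nat \<Rightarrow> 'a) \<Rightarrow> 'a measure measure) \<Rightarrow> bool" where
  "posterior_version M P X n \<kappa> \<longleftrightarrow>
     \<kappa> \<in> sample_space n \<rightarrow>\<^sub>M prob_algebra borel_P \<and>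
     (\<forall>A B. (\<forall>i<n. A i \<in> sets borel) \<longrightarrow> B \<in> sets borel_P \<longrightarrow>
        measure M {\<omega>\<in>space M. (\<forall>i<n. X i \<omega> \<in> A i) \<and> P \<omega> \<in> B} =
        (LINT x:PiE {..<n} A|distr M (sample_space n) (sample X n). measure (\<kappa> x) B))"

section \<open>Contraction rates\<close>

definition posterior_contraction_rate ::
    "'w measure \<Rightarrow> (nat \<Rightarrow> (nat \<Rightarrow> 'a::metric_space) \<Rightarrow> 'a measure measure) \<Rightarrow> (nat \<Rightarrow> 'w \<Rightarrow> 'a) \<Rightarrow>
     'a measure \<Rightarrow> real \<Rightarrow> (nat \<Rightarrow> real) \<Rightarrow> bool" where
  "posterior_contraction_rate M \<kappa> \<xi> p0 p \<epsilon> \<longleftrightarrow>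
     (\<forall>n\<ge>1. 0 < \<epsilon> n) \<and>
     (\<forall>K::nat \<Rightarrow> real. (\<forall>n. 0 < K n) \<longrightarrow> filterlim K at_top sequentially \<longrightarrow>
        (\<forall>\<eta>>0. (\<lambda>n. measure M {\<omega>\<in>space M.
            \<eta> < measure (\<kappa> n (sample \<xi> n \<omega>)) {\<mu>\<in>prob_measures. K n * \<epsilon> n \<le> W_P p \<mu> p0}})
          \<longlonglongrightarrow> 0))"

definition wasserstein_posterior_contraction_rate ::
    "'w measure \<Rightarrow> (nat \<Rightarrow> (nat \<Rightarrow> 'a::metric_space) \<Rightarrow> 'a measure measure) \<Rightarrow> (nat \<Rightarrow> 'w \<Rightarrow> 'a) \<Rightarrow>
     'a measure \<Rightarrow> real \<Rightarrow> (nat \<Rightarrow> real) \<Rightarrow> bool" where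
  "wasserstein_posterior_contraction_rate M \<kappa> \<xi> p0 p \<epsilon> \<longleftrightarrow>
     posterior_contraction_rate M \<kappa> \<xi> p0 p \<epsilon> \<and>
     (\<forall>n\<ge>1. (\<integral>\<omega>. W_PP p (\<kappa> n (sample \<xi> n \<omega>)) (return borel_P p0) \<partial>M) \<le> \<epsilon> n)"

section \<open>Ingredients of the bound\<close>

definition GC_rate ::
    "'w measure \<Rightarrow> (nat \<Rightarrow> 'w \<Rightarrow> 'a::metric_space) \<Rightarrow> 'a measure \<Rightarrow> real \<Rightarrow> nat \<Rightarrow> real" where
  "GC_rate M \<xi> p0 p n = (\<integral>\<omega>. W_P p (empirical n (sample \<xi> n \<omega>)) p0 \<partial>M)"

text \<open>Minimal number of open \<open>\<delta>\<close>-balls covering \<open>S\<close>; only meaningful for totally bounded \<open>S\<close>.\<close>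

definition covering_number :: "'a::metric_space set \<Rightarrow> real \<Rightarrow> nat" where
  "covering_number S \<delta> = Inf {card F | F. finite F \<and> F \<subseteq> S \<and> S \<subseteq> (\<Union>x\<in>F. ball x \<delta>)}"

definition admissible_partition :: "'a::metric_space measure \<Rightarrow> real \<Rightarrow> (nat \<Rightarrow> 'a set) \<Rightarrow> bool" where
  "admissible_partition \<mu>\<^sub>1 \<delta> A \<longleftrightarrow>
     (let N = covering_number (UNIV :: 'a set) \<delta> in
       disjoint_family_on A {..<N} \<and> (\<Union>j<N. A j) = UNIV \<and>
       (\<forall>j<N. A j \<in> sets borel \<and> diameter (A j) \<le> 2 * \<delta> \<and> measure \<mu>\<^sub>1 (frontier (A j)) = 0))"

definition cell_count :: "'a set \<Rightarrow> nat \<Rightarrow> (nat \<Rightarrow> 'a) \<Rightarrow> nat" where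
  "cell_count A n z = card {i\<in>{..<n}. z i \<in> A}"

definition cell_freq :: "'a set \<Rightarrow> nat \<Rightarrow> (nat \<Rightarrow> 'a) \<Rightarrow> real" where
  "cell_freq A n z = real (cell_count A n z) / real n"

definition cell_law :: "'w measure \<Rightarrow> ('w \<Rightarrow> 'a measure) \<Rightarrow> 'a set \<Rightarrow> real measure" where
  "cell_law M P A = distr M borel (\<lambda>\<omega>. measure (P \<omega>) A)"

text \<open>The exponents \<open>n\<phi>\<close> and \<open>n(1 - \<phi>)\<close> are the integers \<open>k\<close> and \<open>n - k\<close>, where \<open>k\<close> is the
  cell count. Integer powers are used because \<open>0\<^sup>0 = 1\<close> is intended, while \<open>0 powr 0 = 0\<close>.\<close>

definition post_mean :: "real measure \<Rightarrow> nat \<Rightarrow> nat \<Rightarrow> real" where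
  "post_mean \<rho> n k =
     (LINT t:{0..1}|\<rho>. t ^ (1 + k) * (1 - t) ^ (n - k)) / (LINT t:{0..1}|\<rho>. t ^ k * (1 - t) ^ (n - k))"

definition post_var :: "real measure \<Rightarrow> nat \<Rightarrow> nat \<Rightarrow> real" where
  "post_var \<rho> n k =
     (LINT t:{0..1}|\<rho>. (t - post_mean \<rho> n k)\<^sup>2 * t ^ k * (1 - t) ^ (n - k)) /
     (LINT t:{0..1}|\<rho>. t ^ k * (1 - t) ^ (n - k))"

definition M_term ::
    "'w measure \<Rightarrow> ('w \<Rightarrow> 'a measure) \<Rightarrow> (nat \<Rightarrow> 'w \<Rightarrow> 'a) \<Rightarrow> (nat \<Rightarrow> 'a set) \<Rightarrow> nat \<Rightarrow> nat \<Rightarrow> real" where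
  "M_term M P \<xi> A N n = (\<Sum>j<N. \<integral>\<omega>.
     \<bar>cell_freq (A j) n (sample \<xi> n \<omega>) -
      post_mean (cell_law M P (A j)) n (cell_count (A j) n (sample \<xi> n \<omega>))\<bar> \<partial>M)"

definition V_term ::
    "'w measure \<Rightarrow> ('w \<Rightarrow> 'a measure) \<Rightarrow> (nat \<Rightarrow> 'w \<Rightarrow> 'a) \<Rightarrow> (nat \<Rightarrow> 'a set) \<Rightarrow> nat \<Rightarrow> nat \<Rightarrow> real" where
  "V_term M P \<xi> A N n = (\<Sum>j<N. \<integral>\<omega>.
     sqrt (post_var (cell_law M P (A j)) n (cell_count (A j) n (sample \<xi> n \<omega>))) \<partial>M)"

definition rate_bound ::
    "'w measure \<Rightarrow> ('w \<Rightarrow> 'a::metric_space measure) \<Rightarrow> (nat \<Rightarrow> 'w \<Rightarrow> 'a) \<Rightarrow> 'a measure \<Rightarrow> real \<Rightarrow>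
     (nat \<Rightarrow> real) \<Rightarrow> (real \<Rightarrow> nat \<Rightarrow> 'a set) \<Rightarrow> (nat \<Rightarrow> real) \<Rightarrow> nat \<Rightarrow> real" where
  "rate_bound M P \<xi> p0 p L A \<delta> n =
     (let N = covering_number (UNIV :: 'a set) (\<delta> n) in
       GC_rate M \<xi> p0 p n + 2 * (2 + L n) * \<delta> n +
       diameter (UNIV :: 'a set) *
         (1 / 2 * (M_term M P \<xi> (A (\<delta> n)) N n + V_term M P \<xi> (A (\<delta> n)) N n)) powr (1 / p))"

end

theory Submission
  imports Defs
begin

text \<open>Take \<open>\<delta> n = n powr (- \<beta>)\<close> with \<open>\<beta> = (\<alpha> + p * s) / (d + p)\<close>. This balances \<open>L n * \<delta> n\<close>, of
  order \<open>n powr (s - \<beta>)\<close>, against the \<open>p\<close>-th root of \<open>N * n powr (- \<alpha>)\<close>, of order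
  \<open>n powr ((\<beta> * d - \<alpha>) / p)\<close>: both exponents equal \<open>- (\<alpha> - d * s) / (d + p)\<close>. Since the first
  term attains this order and the second is nonnegative, the whole bound minus the
  Glivenko-Cantelli rate has this exact order, and it can itself be taken as \<open>r\<close>.\<close>

text \<open>\<open>diameter\<close> is a real supremum, so its nonnegativity on the whole space
  requires boundedness; finitely many unit balls provide it.\<close>

lemma totally_bounded_imp_bounded:
  fixes S :: "'a::metric_space set"
  assumes "totally_bounded S"
  shows "bounded S"
proof -
  have "\<exists>F. finite F \<and> S \<subseteq> (\<Union>x\<in>F. {y. dist x y < 1})"
    using assms unfolding totally_bounded_metric by (elim allE[of _ 1]) simp
  then obtain F where "finite F" and F: "S \<subseteq> (\<Union>x\<in>F. ball x 1)"
    unfolding ball_def by blast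
  thus ?thesis
    by (intro bounded_subset[OF _ F] bounded_UN) auto
qed

lemma M_term_nonneg: "0 \<le> M_term M P \<xi> A N n"
  unfolding M_term_def by (intro sum_nonneg integral_nonneg_AE) simp

text \<open>Powers of \<open>t\<close> and \<open>1 - t\<close> can be negative only off the unit
  interval, where the indicator of the set integral vanishes. A zero denominator is harmless, the
  quotient then being 0.\<close>

lemma post_var_nonneg: "0 \<le> post_var \<rho> n k"
  unfolding post_var_def set_lebesgue_integral_def
  by (intro divide_nonneg_nonneg integral_nonneg_AE AE_I2) (auto simp: indicator_def)

lemma V_term_nonneg: "0 \<le> V_term M P \<xi> A N n"
  unfolding V_term_def by (intro sum_nonneg integral_nonneg_AE) (simp add: post_var_nonneg)

theorem corollary3p1:
  fixes M :: "'w measure"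
    and \<pi> :: "'a::{metric_space, second_countable_topology} measure measure"
    and P :: "'w \<Rightarrow> 'a measure"
    and X \<xi> :: "nat \<Rightarrow> 'w \<Rightarrow> 'a"
    and p0 :: "'a measure"
    and \<kappa> :: "nat \<Rightarrow> (nat \<Rightarrow> 'a) \<Rightarrow> 'a measure measure"
    and L :: "nat \<Rightarrow> real"
    and A :: "real \<Rightarrow> nat \<Rightarrow> 'a set"
    and p d s \<alpha> C :: real
  assumes p: "1 \<le> p"
    and X_totally_bounded: "totally_bounded (UNIV :: 'a set)"
    and X_polish: "completely_metrizable_space (euclidean :: 'a topology)"
    and M: "prob_space M"
    and prior: "\<pi> \<in> space (prob_algebra borel_P)"
    and P: "P \<in> M \<rightarrow>\<^sub>M borel_P" "distr M borel_P P = \<pi>"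
    and X: "cond_iid M P X"
    and p0: "p0 \<in> prob_measures"
    and data: "prob_space.indep_vars M (\<lambda>_. borel) \<xi> UNIV" "\<And>i. distr M borel (\<xi> i) = p0"
    and posterior: "\<And>n. 1 \<le> n \<Longrightarrow> posterior_version M P X n (\<kappa> n)"
    and L_pos: "\<And>n. 1 \<le> n \<Longrightarrow> 0 < L n"
    and lipschitz: "\<And>n x y. 1 \<le> n \<Longrightarrow> x \<in> space (sample_space n) \<Longrightarrow> y \<in> space (sample_space n) \<Longrightarrow>
        W_PP p (\<kappa> n x) (\<kappa> n y) \<le> L n * W_P p (empirical n x) (empirical n y)"
    and partition: "\<And>\<delta>. 0 < \<delta> \<Longrightarrow> admissible_partition (distr M borel (X 0)) \<delta> (A \<delta>)"
    and i: "0 < d"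
        "(\<lambda>\<delta>. real (covering_number (UNIV :: 'a set) \<delta>)) \<in> \<Theta>[at_right 0](\<lambda>\<delta>. (1 / \<delta>) powr d)"
    and ii: "0 \<le> s" "L \<in> \<Theta>(\<lambda>n. real n powr s)"
    and iii: "0 < C" "s * d < \<alpha>"
        "\<And>\<delta> n. 0 < \<delta> \<Longrightarrow> 1 \<le> n \<Longrightarrow>
           M_term M P \<xi> (A \<delta>) (covering_number (UNIV :: 'a set) \<delta>) n +
           V_term M P \<xi> (A \<delta>) (covering_number (UNIV :: 'a set) \<delta>) n
           \<le> C * real (covering_number (UNIV :: 'a set) \<delta>) * real n powr (- \<alpha>)"
  shows "\<exists>\<delta> r :: nat \<Rightarrow> real.
      (\<forall>n. 0 < \<delta> n) \<and> \<delta> \<longlonglongrightarrow> 0 \<and>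
      r \<in> \<Theta>(\<lambda>n. real n powr (- ((\<alpha> - d * s) / (d + p)))) \<and>
      (\<forall>n\<ge>1. rate_bound M P \<xi> p0 p L A \<delta> n \<le> GC_rate M \<xi> p0 p n + r n) \<and>
      (wasserstein_posterior_contraction_rate M \<kappa> \<xi> p0 p (rate_bound M P \<xi> p0 p L A \<delta>) \<longrightarrow>
       wasserstein_posterior_contraction_rate M \<kappa> \<xi> p0 p (\<lambda>n. GC_rate M \<xi> p0 p n + r n))"
proof -
  define \<beta> where "\<beta> = (\<alpha> + p * s) / (d + p)"
  define \<gamma> where "\<gamma> = (\<alpha> - d * s) / (d + p)"
  \<comment> \<open>Since \<open>0 powr a = 0\<close>, the maximum with 1 keeps
    \<open>\<delta> 0\<close> positive; all other values are plain powers of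
    \<open>n\<close>.\<close>
  define \<delta> :: "nat \<Rightarrow> real" where "\<delta> = (\<lambda>n. real (max 1 n) powr (- \<beta>))"
  define N where "N = (\<lambda>n. covering_number (UNIV :: 'a set) (\<delta> n))"
  define T where "T = (\<lambda>n. M_term M P \<xi> (A (\<delta> n)) (N n) n + V_term M P \<xi> (A (\<delta> n)) (N n) n)"
  define D where "D = (\<lambda>n. diameter (UNIV :: 'a set) * (1 / 2 * T n) powr (1 / p))"
  define r where "r = (\<lambda>n. 2 * (2 + L n) * \<delta> n + D n)"
  \<comment> \<open>With \<open>s * d < \<alpha>\<close> these signs give
    \<open>\<alpha> > 0\<close>, hence a positive numerator of \<open>\<beta>\<close>.\<close>
  have "0 \<le> s * d" "0 \<le> p * s"
    using p i(1) ii(1) by simp_all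
  hence \<beta>: "\<beta> > 0"
    unfolding \<beta>_def using p i(1) iii(2) by (intro divide_pos_pos) linarith+
  have \<beta>s: "s - \<beta> = - \<gamma>" and \<beta>d: "(\<beta> * d - \<alpha>) / p = - \<gamma>"
    using p i(1) unfolding \<beta>_def \<gamma>_def by (simp_all add: divide_simps) (simp_all add: algebra_simps)
  have \<delta>_pos: "\<delta> n > 0" for n
    by (simp add: \<delta>_def)
  have \<delta>_ev: "eventually (\<lambda>n. \<delta> n = real n powr (- \<beta>)) sequentially"
    using eventually_ge_at_top[of 1] by eventually_elim (simp add: \<delta>_def max_def)
  have "(\<lambda>n. real n powr (- \<beta>)) \<longlonglongrightarrow> 0"
    using \<beta> by (intro tendsto_neg_powr filterlim_real_sequentially) simp
  hence \<delta>_lim: "\<delta> \<longlonglongrightarrow> 0"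
    using tendsto_cong[OF \<delta>_ev] by simp
  \<comment> \<open>The covering asymptotics hold along \<open>at_right 0\<close>; positivity of
    \<open>\<delta>\<close> permits substituting \<open>\<delta> n\<close> there.\<close>
  have \<delta>_right: "filterlim \<delta> (at_right 0) sequentially"
    using \<delta>_lim \<delta>_pos by (intro filterlim_at_withinI) (auto simp: less_imp_neq[THEN not_sym])

  have T_nonneg: "0 \<le> T n" for n
    unfolding T_def by (intro add_nonneg_nonneg M_term_nonneg V_term_nonneg)
  have diam: "0 \<le> diameter (UNIV :: 'a set)"
    by (intro diameter_ge_0 totally_bounded_imp_bounded X_totally_bounded)
  have D_nonneg: "0 \<le> D n" for n
    unfolding D_def using diam by simp

  have N: "(\<lambda>n. real (N n)) \<in> O(\<lambda>n. real n powr (\<beta> * d))"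
  proof -
    have "(\<lambda>n. real (N n)) \<in> O(\<lambda>n. (1 / \<delta> n) powr d)"
      unfolding N_def using landau_o.big.compose[OF bigthetaD1[OF i(2)] \<delta>_right] .
    moreover have "eventually (\<lambda>n. (1 / \<delta> n) powr d = real n powr (\<beta> * d)) sequentially"
      using \<delta>_ev by eventually_elim (simp add: powr_divide powr_powr powr_minus inverse_eq_divide)
    ultimately show ?thesis
      by (simp cong: landau_o.big.cong)
  qed
  have T: "T \<in> O(\<lambda>n. real n powr (\<beta> * d - \<alpha>))"
  proof -
    have "eventually (\<lambda>n. norm (T n) \<le> 1 * norm (C * real (N n) * real n powr (- \<alpha>))) sequentially"
      using eventually_ge_at_top[of 1]
    proof eventually_elim
      case (elim n)
      have "T n \<le> C * real (N n) * real n powr (- \<alpha>)"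
        unfolding T_def N_def using iii(3)[OF \<delta>_pos elim] .
      thus ?case
        using T_nonneg[of n] by simp
    qed
    hence "T \<in> O(\<lambda>n. C * real (N n) * real n powr (- \<alpha>))"
      by (rule bigoI)
    also have "(\<lambda>n. C * real (N n) * real n powr (- \<alpha>)) \<in> O(\<lambda>n. real n powr (\<beta> * d) * real n powr (- \<alpha>))"
      using N iii(1) by (intro landau_o.big.mult) auto
    finally show ?thesis
      by (simp flip: powr_add)
  qed
  have D: "D \<in> O(\<lambda>n. real n powr (- \<gamma>))"
  proof -
    obtain c where c: "c > 0" "eventually (\<lambda>n. norm (T n) \<le> c * norm (real n powr (\<beta> * d - \<alpha>))) sequentially"
      using landau_o.bigE[OF T] by blast
    have "eventually (\<lambda>n. norm (D n) \<le>
        diameter (UNIV :: 'a set) * (c / 2) powr (1 / p) * norm (real n powr (- \<gamma>))) sequentially"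
      using c(2)
    proof eventually_elim
      case (elim n)
      hence "1 / 2 * T n \<le> c / 2 * real n powr (\<beta> * d - \<alpha>)"
        by simp
      \<comment> \<open>Monotonicity of the \<open>p\<close>-th root needs a nonnegative base, which
        is why the signs of \<open>M_term\<close> and \<open>V_term\<close> were
        established.\<close>
      hence "(1 / 2 * T n) powr (1 / p) \<le> (c / 2 * real n powr (\<beta> * d - \<alpha>)) powr (1 / p)"
        using T_nonneg p by (intro powr_mono2) auto
      also have "\<dots> = (c / 2) powr (1 / p) * real n powr (- \<gamma>)"
        using c(1) \<beta>d by (subst powr_mult) (simp_all add: powr_powr)
      finally show ?case
        using diam D_nonneg[of n] by (simp add: D_def mult.assoc mult_left_mono del: times_divide_eq_left)
    qed
    thus ?thesis
      by (rule bigoI)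
  qed
  have L\<delta>: "(\<lambda>n. L n * \<delta> n) \<in> \<Theta>(\<lambda>n. real n powr (- \<gamma>))"
  proof -
    have "\<delta> \<in> \<Theta>(\<lambda>n. real n powr (- \<beta>))"
      using \<delta>_ev by (rule bigthetaI_cong)
    from landau_theta.mult[OF ii(2) this] show ?thesis
      by (simp add: \<beta>s flip: powr_add)
  qed
  \<comment> \<open>This handles the part \<open>4 * \<delta> n\<close> of
    \<open>2 * (2 + L n) * \<delta> n\<close>: as \<open>s \<ge> 0\<close>, the exponent
    \<open>- \<beta>\<close> is at most \<open>s - \<beta> = - \<gamma>\<close>.\<close>
  have "\<delta> \<in> O(\<lambda>n. real n powr (- \<gamma>))"
  proof -
    have "eventually (\<lambda>n. norm (\<delta> n) \<le> 1 * norm (real n powr (- \<gamma>))) sequentially"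
      using \<delta>_ev eventually_ge_at_top[of 1]
      by eventually_elim (use \<beta>s ii(1) in \<open>auto intro!: powr_mono\<close>)
    thus ?thesis by (rule bigoI)
  qed
  hence "(\<lambda>n. 4 * \<delta> n + 2 * (L n * \<delta> n) + D n) \<in> O(\<lambda>n. real n powr (- \<gamma>))"
    using bigthetaD1[OF L\<delta>] D by (intro sum_in_bigo) auto
  hence r_upper: "r \<in> O(\<lambda>n. real n powr (- \<gamma>))"
    by (simp add: r_def algebra_simps)
  \<comment> \<open>Lower bound for \<open>r\<close>: its summands are nonnegative for
    \<open>n \<ge> 1\<close>, so no cancellation occurs and
    \<open>L n * \<delta> n \<le> r n\<close>.\<close>
  have "(\<lambda>n. real n powr (- \<gamma>)) \<in> O(\<lambda>n. L n * \<delta> n)"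
    using L\<delta> by (simp add: bigtheta_sym bigthetaD1)
  also have "(\<lambda>n. L n * \<delta> n) \<in> O(r)"
  proof (rule bigoI[of _ 1])
    show "eventually (\<lambda>n. norm (L n * \<delta> n) \<le> 1 * norm (r n)) sequentially"
      using eventually_ge_at_top[of 1]
    proof eventually_elim
      case (elim n)
      hence "0 < L n * \<delta> n"
        using L_pos \<delta>_pos by simp
      thus ?case
        using D_nonneg[of n] \<delta>_pos[of n] by (simp add: r_def algebra_simps)
    qed
  qed
  finally have "r \<in> \<Theta>(\<lambda>n. real n powr (- \<gamma>))"
    using r_upper by (auto simp: bigtheta_def bigomega_iff_bigo)
  \<comment> \<open>Because this is an equality of functions, both the pointwise bound and the
    transfer of the contraction rate are immediate.\<close>
  moreover have "rate_bound M P \<xi> p0 p L A \<delta> = (\<lambda>n. GC_rate M \<xi> p0 p n + r n)"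
    by (simp add: fun_eq_iff rate_bound_def Let_def r_def D_def T_def N_def)
  ultimately show ?thesis
    using \<delta>_pos \<delta>_lim unfolding \<gamma>_def by (intro exI[of _ \<delta>] exI[of _ r]) simp
qed

end
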